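(* Let $m\ge 2$, let $\rho_0$ be a fixed (initial) partition of $[m]=\{1,\ldots,m\}$ with cluster labels $c_{01},\ldots,c_{0m}$, let $\bm{\alpha}=(\alpha_1,\ldots,\alpha_m)\in[0,1]^m$, and let $\rho$ be distributed according to the informed partition prior $p(\rho\mid\rho_0,\bm{\alpha})=\sum_{\bm{\gamma}\in\Gamma}p(\rho\mid\rho_0,\bm{\gamma})p(\bm{\gamma}\mid\bm{\alpha})$. For $\bm{\gamma}\in\Gamma$ and $i\neq j$, let $\bm{\gamma}^{-(i,j)}$ denote $\bm{\gamma}$ with $\gamma_i$ and $\gamma_j$ removed, let $\mathfrak{R}=\{i:\gamma_i=1\}$, and define $$\mathcal{M}_{i,j}(\bm{\gamma}^{-(i,j)},\gamma_i,\gamma_j)=\begin{cases} I\{c_{0i}=c_{0j}\} & \text{if }\gamma_i=\gamma_j=1,\\[4pt] \dfrac{\bar p(\mathfrak{T}_{i,j}(\rho_0^{\mathfrak{R}}))}{\bar p(\rho_0^{\mathfrak{R}})} & \text{if }\gamma_i=1,\gamma_j=0,\\[8pt] \dfrac{\bar p(\mathfrak{T}_{j,i}(\rho_0^{\mathfrak{R}}))}{\bar p(\rho_0^{\mathfrak{R}})} & \text{if }\gamma_i=0,\gamma_j=1,\\[8pt] \displaystyle\sum_{\ell=1}^{|\rho_0^{\mathfrak{R}}|+1}\dfrac{\bar p(\mathfrak{T}^{+\ell}_{i,j}(\rho_0^{\mathfrak{R}}))}{\bar p(\rho_0^{\mathfrak{R}})} & \text{if }\gamma_i=\gamma_j=0.\end{cases}$$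 Then the expected Rand index between $\rho_0$ and $\rho$ is $$E(R(\rho_0,\rho)\mid\bm{\alpha})=\frac{1}{\binom{m}{2}}\sum_{\bm{\gamma}\in\Gamma}\ \sum_{1\le i<j\le m}\Big\{\mathcal{M}_{i,j}(\bm{\gamma}^{-(i,j)},\gamma_i,\gamma_j)\,I\{c_{0i}=c_{0j}\}+\big(1-\mathcal{M}_{i,j}(\bm{\gamma}^{-(i,j)},\gamma_i,\gamma_j)\big)\,I\{c_{0i}\neq c_{0j}\}\Big\}\,p(\bm{\gamma}\mid\bm{\alpha}).$$
   Context: Partitions: a partition of a finite set is a set of non-empty, pairwise disjoint subsets (clusters) whose union is that set. $\mathcal{P}$ denotes the set of all partitions of $[m]=\{1,\ldots,m\}$. Clusters are numbered in a fixed (lexicographic) order, and cluster labels $c_i$ record the number of the cluster containing unit $i$, so $c_i=c_j$ iff $i,j$ are in the same cluster; $c_{0i}$ are the labels for $\rho_0$. $|\rho|$ is the number of clusters of $\rho$. Rand index: $R(\rho_0,\rho)=(\upsilon_1+\upsilon_2)/\binom m2$, where $\upsilon_1$ is the number of unordered pairs $\{i,j\}\subseteq[m]$, $i\ne j$, that are in the same cluster in both $\rho_0$ and $\rho$, and $\upsilon_2$ is the number of such pairs that are in different clusters in both $\rho_0$ and $\rho$. EPPF: an exchangeable partition probability function is a function $\mathfrak{p}\ge 0$ on finite sequences of positive integers, symmetric in its arguments, with $\mathfrak{p}(1)=1$ and satisfying the sample size consistency property $\mathfrak{p}(n_1,\ldots,n_k)=\sum_{j=1}^k\mathfrak{p}(n_1,\ldots,n_j+1,\ldots,n_k)+\mathfrak{p}(n_1,\ldots,n_k,1)$.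 Fix such an EPPF. For a partition $\rho=\{S_1,\ldots,S_k\}$ of any finite set, $\bar p(\rho)=\mathfrak{p}(|S_1|,\ldots,|S_k|)$, and $\bar p(\emptyset)=1$ for the empty partition. It is assumed that $\bar p(\lambda)>0$ for every $\lambda\in\mathcal{P}$, so that the conditional probabilities below are well defined. Reallocation indicators: $\Gamma=\{0,1\}^m$; for $\bm{\gamma}\in\Gamma$, $p(\bm{\gamma}\mid\bm{\alpha})=\prod_{i=1}^m\alpha_i^{\gamma_i}(1-\alpha_i)^{1-\gamma_i}$. With $\mathfrak{R}=\{i:\gamma_i=1\}$ and $\rho$ a partition of $[m]$, $\rho^{\mathfrak{R}}$ is the partition of $\mathfrak{R}$ obtained by removing from the clusters of $\rho$ all units $i$ with $\gamma_i=0$ and discarding empty clusters. Let $\mathcal{P}_C(\rho_0,\bm{\gamma})=\{\rho\in\mathcal{P}:\rho^{\mathfrak{R}}=\rho_0^{\mathfrak{R}}\}$, and for $\lambda\in\mathcal{P}$ $$p(\lambda\mid\rho_0,\bm{\gamma})=\frac{\bar p(\lambda)\,I\{\lambda\in\mathcal{P}_C(\rho_0,\bm{\gamma})\}}{\sum_{\lambda'\in\mathcal{P}}\bar p(\lambda')\,I\{\lambda'\in\mathcal{P}_C(\rho_0,\bm{\gamma})\}}.$$ Reallocation maps on reduced partitions: if $\gamma_i=1,\gamma_j=0$, $\mathfrak{T}_{i,j}(\rho_0^{\mathfrak{R}})$ is the partition of $\mathfrak{R}\cup\{j\}$ obtained from $\rho_0^{\mathfrak{R}}$ by adding unit $j$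 to the cluster containing unit $i$. If $\gamma_i=\gamma_j=0$, then for $1\le\ell\le|\rho_0^{\mathfrak{R}}|$, $\mathfrak{T}^{+\ell}_{i,j}(\rho_0^{\mathfrak{R}})$ is the partition of $\mathfrak{R}\cup\{i,j\}$ obtained by adding both $i$ and $j$ to the $\ell$-th cluster of $\rho_0^{\mathfrak{R}}$, and for $\ell=|\rho_0^{\mathfrak{R}}|+1$ it is obtained by adding the new cluster $\{i,j\}$. $I$ denotes an indicator. *)

theory Defs
  imports "HOL-Probability.Probability" "HOL-Library.List_Lexorder"
begin

definition partitions_upto :: "nat \<Rightarrow> nat set set set" where
  "partitions_upto m = {\<rho>. partition_on {1..m} \<rho>}"

text \<open>Clusters are compared lexicographically through their increasingly sorted lists of elements.\<close>

definition cluster_list :: "nat set set \<Rightarrow> nat set list" where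
  "cluster_list \<rho> = sorted_key_list_of_set sorted_list_of_set \<rho>"

definition nth_cluster :: "nat set set \<Rightarrow> nat \<Rightarrow> nat set" where
  "nth_cluster \<rho> l = cluster_list \<rho> ! (l - 1)"  \<comment> \<open>numbering starts at 1\<close>

definition cluster_label :: "nat set set \<Rightarrow> nat \<Rightarrow> nat" where
  "cluster_label \<rho> i = (THE l. l \<in> {1..card \<rho>} \<and> i \<in> nth_cluster \<rho> l)"

definition same_cluster :: "nat set set \<Rightarrow> nat \<Rightarrow> nat \<Rightarrow> bool" where
  "same_cluster \<rho> i j \<longleftrightarrow> (\<exists>C\<in>\<rho>. i \<in> C \<and> j \<in> C)"

definition rand_index :: "nat \<Rightarrow> nat set set \<Rightarrow> nat set set \<Rightarrow> real" where
  "rand_index m \<rho>\<^sub>0 \<rho> =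
     (real (card {{i, j} | i j. i \<in> {1..m} \<and> j \<in> {1..m} \<and> i \<noteq> j \<and>
                    same_cluster \<rho>\<^sub>0 i j \<and> same_cluster \<rho> i j})
      + real (card {{i, j} | i j. i \<in> {1..m} \<and> j \<in> {1..m} \<and> i \<noteq> j \<and>
                    \<not> same_cluster \<rho>\<^sub>0 i j \<and> \<not> same_cluster \<rho> i j}))
     / real (m choose 2)"

text \<open>
  Only the values on non-empty lists of positive integers are constrained; the other values of the
  total function \<open>p\<close> are never used below.
\<close>

definition pos_seq :: "nat list \<Rightarrow> bool" where
  "pos_seq ns \<longleftrightarrow> ns \<noteq> [] \<and> (\<forall>n\<in>set ns. 0 < n)"

definition eppf :: "(nat list \<Rightarrow> real) \<Rightarrow> bool" where
  "eppf p \<longleftrightarrow>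
     (\<forall>ns. pos_seq ns \<longrightarrow> 0 \<le> p ns) \<and>
     (\<forall>ns ns'. pos_seq ns \<longrightarrow> mset ns = mset ns' \<longrightarrow> p ns = p ns') \<and>
     p [1] = 1 \<and>
     (\<forall>ns. pos_seq ns \<longrightarrow>
        p ns = (\<Sum>j<length ns. p (ns[j := ns ! j + 1])) + p (ns @ [1]))"

definition pbar :: "(nat list \<Rightarrow> real) \<Rightarrow> nat set set \<Rightarrow> real" where
  "pbar p \<rho> = (if \<rho> = {} then 1 else p (map card (cluster_list \<rho>)))"

definition Gammas :: "nat \<Rightarrow> (nat \<Rightarrow> nat) set" where
  "Gammas m = {1..m} \<rightarrow>\<^sub>E {0, 1}"

definition gamma_prob :: "nat \<Rightarrow> (nat \<Rightarrow> real) \<Rightarrow> (nat \<Rightarrow> nat) \<Rightarrow> real" where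
  "gamma_prob m \<alpha> \<gamma> = (\<Prod>i=1..m. \<alpha> i ^ \<gamma> i * (1 - \<alpha> i) ^ (1 - \<gamma> i))"

definition fixed_units :: "nat \<Rightarrow> (nat \<Rightarrow> nat) \<Rightarrow> nat set" where
  "fixed_units m \<gamma> = {i\<in>{1..m}. \<gamma> i = 1}"

definition reduced :: "nat set set \<Rightarrow> nat set \<Rightarrow> nat set set" where
  "reduced \<rho> R = (\<lambda>C. C \<inter> R) ` \<rho> - {{}}"

definition compatible :: "nat \<Rightarrow> nat set set \<Rightarrow> (nat \<Rightarrow> nat) \<Rightarrow> nat set set set" where
  "compatible m \<rho>\<^sub>0 \<gamma> =
     {\<rho>\<in>partitions_upto m. reduced \<rho> (fixed_units m \<gamma>) = reduced \<rho>\<^sub>0 (fixed_units m \<gamma>)}"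

definition cond_prior ::
    "(nat list \<Rightarrow> real) \<Rightarrow> nat \<Rightarrow> nat set set \<Rightarrow> (nat \<Rightarrow> nat) \<Rightarrow> nat set set \<Rightarrow> real" where
  "cond_prior p m \<rho>\<^sub>0 \<gamma> \<rho> =
     pbar p \<rho> * of_bool (\<rho> \<in> compatible m \<rho>\<^sub>0 \<gamma>)
     / (\<Sum>\<rho>'\<in>partitions_upto m. pbar p \<rho>' * of_bool (\<rho>' \<in> compatible m \<rho>\<^sub>0 \<gamma>))"

definition informed_prior ::
    "(nat list \<Rightarrow> real) \<Rightarrow> nat \<Rightarrow> nat set set \<Rightarrow> (nat \<Rightarrow> real) \<Rightarrow> nat set set \<Rightarrow> real" where
  "informed_prior p m \<rho>\<^sub>0 \<alpha> \<rho> =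
     (\<Sum>\<gamma>\<in>Gammas m. cond_prior p m \<rho>\<^sub>0 \<gamma> \<rho> * gamma_prob m \<alpha> \<gamma>)"

definition join_unit :: "nat \<Rightarrow> nat \<Rightarrow> nat set set \<Rightarrow> nat set set" where
  "join_unit i j \<sigma> = (\<lambda>C. if i \<in> C then insert j C else C) ` \<sigma>"

definition join_pair :: "nat \<Rightarrow> nat \<Rightarrow> nat \<Rightarrow> nat set set \<Rightarrow> nat set set" where
  "join_pair l i j \<sigma> =
     (if l \<le> card \<sigma> then insert (nth_cluster \<sigma> l \<union> {i, j}) (\<sigma> - {nth_cluster \<sigma> l})
      else insert {i, j} \<sigma>)"

definition co_weight ::
    "(nat list \<Rightarrow> real) \<Rightarrow> nat \<Rightarrow> nat set set \<Rightarrow> nat \<Rightarrow> nat \<Rightarrow> (nat \<Rightarrow> nat) \<Rightarrow> real" where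
  "co_weight p m \<rho>\<^sub>0 i j \<gamma> =
     (let \<sigma> = reduced \<rho>\<^sub>0 (fixed_units m \<gamma>) in
      if \<gamma> i = 1 \<and> \<gamma> j = 1 then of_bool (cluster_label \<rho>\<^sub>0 i = cluster_label \<rho>\<^sub>0 j)
      else if \<gamma> i = 1 \<and> \<gamma> j = 0 then pbar p (join_unit i j \<sigma>) / pbar p \<sigma>
      else if \<gamma> i = 0 \<and> \<gamma> j = 1 then pbar p (join_unit j i \<sigma>) / pbar p \<sigma>
      else (\<Sum>l=1..card \<sigma> + 1. pbar p (join_pair l i j \<sigma>) / pbar p \<sigma>))"

end

theory Submission
  imports Defs
begin

text \<open>
  Sample size consistency, iterated, says that for \<open>R \<subseteq> A\<close> the weights \<open>pbar p\<close> of all partitions of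
  \<open>A\<close> that restrict to a given partition \<open>\<sigma>\<close> of \<open>R\<close> add up to \<open>pbar p \<sigma>\<close>. Applied to
  \<open>R = fixed_units m \<gamma>\<close> it evaluates the normalising constant of the conditional prior; applied to
  \<open>A = {1..m}\<close> over \<open>R \<union> {i, j}\<close> it reduces the event that \<open>i\<close> and \<open>j\<close> share a cluster to the
  partitions of \<open>R \<union> {i, j}\<close> extending \<open>\<sigma>\<close>, which are enumerated explicitly. The Rand index is a
  sum over pairs, so linearity of expectation gives the claim.
\<close>

section \<open>Numbering of clusters and symmetry of the EPPF\<close>

text \<open>Injectivity of the key is asked for on \<open>S\<close> only, because the key used for
  clusters, \<open>sorted_list_of_set\<close>, sends all infinite sets to \<open>[]\<close> and is
  injective on finite sets alone. The locale is therefore interpreted with \<open>S\<close> as its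
  carrier.\<close>

lemma (in linorder) sorted_key_list_of_set_inj_on:
  assumes "finite S" "inj_on f S"
  shows "set (sorted_key_list_of_set f S) = S" "distinct (sorted_key_list_of_set f S)"
    "length (sorted_key_list_of_set f S) = card S"
proof -
  interpret folding_insort_key "(\<le>)" "(<)" S f
    by unfold_locales (rule assms(2))
  show "set (sorted_key_list_of_set f S) = S" "length (sorted_key_list_of_set f S) = card S"
    using assms(1) by simp_all
  show "distinct (sorted_key_list_of_set f S)"
    using distinct_sorted_key_list_of_set[OF subset_refl] by (simp add: distinct_map)
qed

lemma cluster_list_partition:
  assumes "finite R" "partition_on R \<sigma>"
  shows "set (cluster_list \<sigma>) = \<sigma>" "distinct (cluster_list \<sigma>)"
    "length (cluster_list \<sigma>) = card \<sigma>"
proof -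
  have "inj_on sorted_list_of_set \<sigma>"
    using assms by (intro inj_onI) (metis Union_upper finite_subset partition_onD1 set_sorted_list_of_set)
  note * = sorted_key_list_of_set_inj_on[OF finite_elements[OF assms] this, folded cluster_list_def]
  show "set (cluster_list \<sigma>) = \<sigma>" "distinct (cluster_list \<sigma>)"
    "length (cluster_list \<sigma>) = card \<sigma>"
    by (rule *)+
qed

text \<open>Two distinct lists with the same set have the same multiset, and an EPPF is symmetric.
  Hence any enumeration of the clusters may replace the lexicographic one, and lists need not be
  sorted again after a cluster is changed or added.\<close>

lemma pbar_eq:
  assumes "eppf p" "finite R" "partition_on R (set xs)" "distinct xs" "xs \<noteq> []"
  shows "pbar p (set xs) = p (map card xs)"
proof -
  note cl = cluster_list_partition[OF assms(2,3)]
  have "mset (cluster_list (set xs)) = mset xs"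
    using cl assms(4) by (metis set_eq_iff_mset_eq_distinct)
  then have "mset (map card xs) = mset (map card (cluster_list (set xs)))"
    by simp
  moreover have "finite C" "C \<noteq> {}" if "C \<in> set xs" for C
    using that assms(2,3) by (auto simp: partition_on_def intro: finite_subset[of C R])
  then have "pos_seq (map card xs)"
    using assms(5) by (simp add: pos_seq_def card_gt_0_iff)
  ultimately have "p (map card xs) = p (map card (cluster_list (set xs)))"
    using assms(1) unfolding eppf_def by blast
  then show ?thesis
    using assms(5) by (simp add: pbar_def)
qed

section \<open>Extensions of a partition to a larger ground set\<close>

text \<open>This generalises \<open>compatible\<close>, which is the case \<open>A = {1..m}\<close>
  with \<sigma> a restriction of \<open>\<rho>\<^sub>0\<close>. A variable ground set makes it
  possible to add units one at a time and to stop at \<open>R \<union> {i, j}\<close>.\<close>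

definition extensions :: "nat set \<Rightarrow> nat set \<Rightarrow> nat set set \<Rightarrow> nat set set set" where
  "extensions A R \<sigma> = {\<tau>. partition_on A \<tau> \<and> reduced \<tau> R = \<sigma>}"

lemma finite_extensions: "finite A \<Longrightarrow> finite (extensions A R \<sigma>)"
  by (rule finite_subset[OF _ finitely_many_partition_on[of A]]) (auto simp: extensions_def)

lemma reduced_partition: "partition_on A \<tau> \<Longrightarrow> R \<subseteq> A \<Longrightarrow> partition_on R (reduced \<tau> R)"
  using partition_on_restrict[of A \<tau> R] by (simp add: reduced_def Int_absorb1 image_def Int_commute)

lemma reduced_reduced: "R \<subseteq> A \<Longrightarrow> reduced (reduced \<tau> A) R = reduced \<tau> R"
proof -
  assume "R \<subseteq> A"
  \<comment> \<open>An empty trace discarded by the first restriction would only produce another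
    empty trace, which the second restriction discards anyway.\<close>
  have "(\<lambda>C. C \<inter> R) ` (X - {{}}) - {{}} = (\<lambda>C. C \<inter> R) ` X - {{}}" for X :: "nat set set"
    by auto
  then have "reduced (reduced \<tau> A) R = (\<lambda>C. C \<inter> R) ` (\<lambda>C. C \<inter> A) ` \<tau> - {{}}"
    unfolding reduced_def .
  also have "\<dots> = reduced \<tau> R"
    using \<open>R \<subseteq> A\<close> by (simp add: reduced_def image_image Int_assoc Int_absorb1)
  finally show ?thesis .
qed

lemma reduced_self: "partition_on R \<sigma> \<Longrightarrow> reduced \<sigma> R = \<sigma>"
proof -
  assume a: "partition_on R \<sigma>"
  then have "(\<lambda>C. C \<inter> R) ` \<sigma> = (\<lambda>C. C) ` \<sigma>"
    by (intro image_cong) (auto simp: partition_on_def)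
  with a show ?thesis by (auto simp: reduced_def partition_on_def)
qed

lemma extensions_self: "partition_on R \<sigma> \<Longrightarrow> extensions R R \<sigma> = {\<sigma>}"
  by (auto simp: extensions_def reduced_self)

lemma same_cluster_reduced:
  assumes "i \<in> A" "j \<in> A"
  shows "same_cluster (reduced \<tau> A) i j \<longleftrightarrow> same_cluster \<tau> i j"
proof
  assume "same_cluster \<tau> i j"
  then obtain C where "C \<in> \<tau>" "i \<in> C" "j \<in> C"
    by (auto simp: same_cluster_def)
  with assms show "same_cluster (reduced \<tau> A) i j"
    unfolding same_cluster_def reduced_def by (intro bexI[of _ "C \<inter> A"]) auto
qed (auto simp: same_cluster_def reduced_def)

text \<open>The element \<open>C = {}\<close> stands for the choice of opening the new cluster \<open>D\<close>.\<close>

lemma bij_betw_glue: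
  assumes \<sigma>: "partition_on R \<sigma>" and D: "D \<noteq> {}" "D \<inter> R = {}"
  shows "bij_betw (\<lambda>C. insert (C \<union> D) (\<sigma> - {C})) (insert {} \<sigma>)
           {\<tau> \<in> extensions (R \<union> D) R \<sigma>. \<exists>B\<in>\<tau>. D \<subseteq> B}"
proof -
  let ?g = "\<lambda>C. insert (C \<union> D) (\<sigma> - {C})"
  have ne: "{} \<notin> \<sigma>" and U: "\<Union>\<sigma> = R" and
    dj: "\<And>B C x. B \<in> \<sigma> \<Longrightarrow> C \<in> \<sigma> \<Longrightarrow> x \<in> B \<Longrightarrow> x \<in> C \<Longrightarrow> B = C"
    using \<sigma> by (auto simp: partition_on_def disjoint_def)
  have sub: "C \<subseteq> R" if "C \<in> insert {} \<sigma>" for C using that U by auto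
  have inj: "inj_on ?g (insert {} \<sigma>)"
  proof (rule inj_onI)
    fix C1 C2 assume C: "C1 \<in> insert {} \<sigma>" "C2 \<in> insert {} \<sigma>" and eq: "?g C1 = ?g C2"
    \<comment> \<open>The cluster containing \<open>D\<close> is the only member of
      \<open>?g C1\<close> outside \<sigma>, so the value of \<open>?g\<close> determines it, and
      removing \<open>D\<close> from it gives back \<open>C1\<close>.\<close>
    have "C1 \<union> D \<notin> \<sigma>" using D U by blast
    with eq have "C1 \<union> D = C2 \<union> D" by blast
    with sub[OF C(1)] sub[OF C(2)] D show "C1 = C2" by blast
  qed
  have into: "?g C \<in> extensions (R \<union> D) R \<sigma>" if C: "C \<in> insert {} \<sigma>" for C
  proof -
    have CR: "C \<subseteq> R" using sub C .
    have dC: "B \<inter> C = {}" if "B \<in> \<sigma> - {C}" for B using that C dj by blast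
    have "partition_on (R \<union> D) (?g C)"
    proof (rule partition_onI)
      show "\<Union>(?g C) = R \<union> D" using U C by blast
      show "{} \<notin> ?g C" using D ne by blast
      show "disjnt B B'" if BB': "B \<in> ?g C" "B' \<in> ?g C" "B \<noteq> B'" for B B'
      proof -
        have *: "disjnt X (C \<union> D)" if "X \<in> \<sigma> - {C}" for X
          using dC[OF that] that U D by (auto simp: disjnt_def)
        have **: "disjnt X Y" if "X \<in> \<sigma>" "Y \<in> \<sigma>" "X \<noteq> Y" for X Y
          unfolding disjnt_iff using that dj by blast
        consider "B = C \<union> D" "B' \<in> \<sigma> - {C}" | "B \<in> \<sigma> - {C}" "B' = C \<union> D"
          | "B \<in> \<sigma>" "B' \<in> \<sigma>"
          using BB' by blast
        then show ?thesis
        proof cases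
          case 1
          then show ?thesis using *[THEN disjnt_sym] by simp
        next
          case 2
          then show ?thesis using * by simp
        next
          case 3
          then show ?thesis using **[OF _ _ BB'(3)] by simp
        qed
      qed
    qed
    moreover have "reduced (?g C) R = \<sigma>"
    proof -
      have "(\<lambda>B. B \<inter> R) ` (\<sigma> - {C}) = (\<lambda>B. B) ` (\<sigma> - {C})"
        using U by (intro image_cong) auto
      moreover have "(C \<union> D) \<inter> R = C" using CR D by blast
      \<comment> \<open>For \<open>C = {}\<close> the new cluster \<open>D\<close> has empty trace
        on \<open>R\<close>, which \<open>reduced\<close> discards; one formula thus covers both
        kinds of choice.\<close>
      ultimately have "reduced (?g C) R = insert C (\<sigma> - {C}) - {{}}"
        by (simp add: reduced_def)
      also have "\<dots> = \<sigma>" using C ne by auto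
      finally show ?thesis .
    qed
    ultimately show ?thesis by (simp add: extensions_def)
  qed
  have onto: "\<tau> \<in> ?g ` insert {} \<sigma>"
    if \<tau>: "partition_on (R \<union> D) \<tau>" "reduced \<tau> R = \<sigma>" and B: "B \<in> \<tau>" "D \<subseteq> B" for \<tau> B
  proof
    have dt: "\<And>X Y x. X \<in> \<tau> \<Longrightarrow> Y \<in> \<tau> \<Longrightarrow> x \<in> X \<Longrightarrow> x \<in> Y \<Longrightarrow> X = Y"
      and nt: "{} \<notin> \<tau>" and Ut: "\<Union>\<tau> = R \<union> D"
      using \<tau> by (auto simp: partition_on_def disjoint_def)
    \<comment> \<open>The preimage is the trace on \<open>R\<close> of the cluster that contains
      \<open>D\<close>; it is empty exactly when \<open>B = D\<close>, that is, when
      \<open>D\<close> forms a cluster of its own.\<close>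
    let ?C = "B \<inter> R"
    have oth: "X \<inter> B = {}" "X \<subseteq> R" "X \<noteq> {}" if "X \<in> \<tau> - {B}" for X
    proof -
      show "X \<inter> B = {}" using that B(1) dt[of X B] by blast
      with that Ut B(2) show "X \<subseteq> R" by blast
      show "X \<noteq> {}" using that nt by auto
    qed
    have "(\<lambda>X. X \<inter> R) ` (\<tau> - {B}) = (\<lambda>X. X) ` (\<tau> - {B})"
      using oth by (intro image_cong) auto
    moreover have "reduced \<tau> R = (\<lambda>X. X \<inter> R) ` insert B (\<tau> - {B}) - {{}}"
      unfolding reduced_def insert_Diff[OF B(1)] ..
    ultimately have "reduced \<tau> R = insert ?C (\<tau> - {B}) - {{}}"
      unfolding image_insert by simp
    then have s: "\<sigma> = insert ?C (\<tau> - {B}) - {{}}" using \<tau> by simp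
    show "?C \<in> insert {} \<sigma>" unfolding s by blast
    \<comment> \<open>The other clusters are non-empty and disjoint from \<open>B\<close>, so
      deleting \<open>?C\<close> from \<sigma> deletes none of them.\<close>
    have "?C \<notin> \<tau> - {B}" using oth(1,3)[of ?C] by auto
    then have "\<sigma> - {?C} = \<tau> - {B}" unfolding s using nt by blast
    moreover have "?C \<union> D = B" using B Ut by blast
    ultimately show "\<tau> = ?g ?C" using insert_Diff[OF B(1)] by simp
  qed
  show ?thesis
  proof (rule bij_betw_imageI[OF inj], intro equalityI subsetI)
    fix \<tau> assume "\<tau> \<in> ?g ` insert {} \<sigma>"
    then obtain C where "C \<in> insert {} \<sigma>" "\<tau> = ?g C" by blast
    then show "\<tau> \<in> {\<tau> \<in> extensions (R \<union> D) R \<sigma>. \<exists>B\<in>\<tau>. D \<subseteq> B}" using into by blast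
  next
    fix \<tau> assume "\<tau> \<in> {\<tau> \<in> extensions (R \<union> D) R \<sigma>. \<exists>B\<in>\<tau>. D \<subseteq> B}"
    then show "\<tau> \<in> ?g ` insert {} \<sigma>" using onto unfolding extensions_def by blast
  qed
qed

section \<open>Sample size consistency for set partitions\<close>

text \<open>This is the consistency equation of the EPPF read on set partitions: its j-th summand
  corresponds to placing \<open>x\<close> in the j-th cluster, its last term to opening the cluster
  \<open>{x}\<close>. The gluing bijection with \<open>D = {x}\<close> matches the two
  sides.\<close>

lemma sum_pbar_one_unit:
  assumes p: "eppf p" and R: "finite R" "partition_on R \<sigma>" and x: "x \<notin> R"
  shows "(\<Sum>\<tau>\<in>extensions (insert x R) R \<sigma>. pbar p \<tau>) = pbar p \<sigma>"
proof -
  let ?g = "\<lambda>C. insert (C \<union> {x}) (\<sigma> - {C})"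
  \<comment> \<open>For a single new unit the side condition is automatic, since some cluster must
    cover \<open>x\<close>.\<close>
  have *: "{\<tau> \<in> extensions (R \<union> {x}) R \<sigma>. \<exists>B\<in>\<tau>. {x} \<subseteq> B} = extensions (insert x R) R \<sigma>"
    by (auto simp: extensions_def partition_on_def)
  have bij: "bij_betw ?g (insert {} \<sigma>) (extensions (insert x R) R \<sigma>)"
    using bij_betw_glue[OF R(2), of "{x}"] x unfolding * by simp
  have part: "partition_on (insert x R) (?g C)" if "C \<in> insert {} \<sigma>" for C
    using bij_betwE[OF bij] that by (auto simp: extensions_def)
  have fin: "finite \<sigma>" using R finite_elements by blast
  have ne: "{} \<notin> \<sigma>" using R by (auto simp: partition_on_def)
  have "(\<Sum>\<tau>\<in>extensions (insert x R) R \<sigma>. pbar p \<tau>) = (\<Sum>C\<in>insert {} \<sigma>. pbar p (?g C))"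
    by (rule sum.reindex_bij_betw[OF bij, symmetric])
  also have "\<dots> = pbar p (insert {x} \<sigma>) + (\<Sum>C\<in>\<sigma>. pbar p (?g C))"
    using fin ne by simp
  also have "\<dots> = pbar p \<sigma>"
  \<comment> \<open>The consistency equation concerns non-empty lists only. For the empty partition
    the claim is instead \<open>p [1] = 1\<close>, in agreement with the convention for
    \<open>pbar\<close> at \<open>{}\<close>.\<close>
  proof (cases "\<sigma> = {}")
    case True
    then have "pbar p (insert {x} \<sigma>) = p [1]"
      using pbar_eq[OF p, of "{x}" "[{x}]"] by (simp add: partition_on_def)
    with True p show ?thesis by (simp add: pbar_def eppf_def)
  next
    case False
    define xs where "xs = cluster_list \<sigma>"
    have xs: "set xs = \<sigma>" "distinct xs" using cluster_list_partition[OF R] by (auto simp: xs_def)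
    with False have xs0: "xs \<noteq> []" by auto
    have xU: "\<And>C. C \<in> \<sigma> \<Longrightarrow> C \<subseteq> R" using R(2) by (auto simp: partition_on_def)
    have finC: "finite C" if "C \<in> \<sigma>" for C using xU[OF that] R finite_subset by blast
    have 1: "pbar p (insert {x} \<sigma>) = p (map card xs @ [1])"
      using pbar_eq[OF p, of "insert x R" "xs @ [{x}]"] part[of "{}"] xs R xU ne x by auto
    have 2: "pbar p (?g (xs ! k)) = p ((map card xs)[k := map card xs ! k + 1])"
      if k: "k < length xs" for k
    proof -
      \<comment> \<open>Updating the enumeration at position \<open>k\<close> enumerates the
        enlarged partition. It stays distinct because the new entry contains \<open>x\<close> and no
        cluster of \<sigma> does.\<close>
      let ?ys = "xs[k := xs ! k \<union> {x}]"
      have mem: "xs ! k \<in> \<sigma>" using k xs by auto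
      have s: "set ?ys = ?g (xs ! k)"
        using set_update_distinct[OF xs(2) k] xs by simp
      have d: "distinct ?ys"
        using xs x xU k by (intro distinct_list_update) auto
      have "card (xs ! k \<union> {x}) = card (xs ! k) + 1"
        using finC[OF mem] xU[OF mem] x by (subst Un_commute) (auto simp: card_insert_if)
      then show ?thesis
        using pbar_eq[OF p, of "insert x R" ?ys] part[of "xs ! k"] mem R s d xs0 k
        by (simp add: map_update)
    qed
    have "(\<Sum>C\<in>\<sigma>. pbar p (?g C)) = (\<Sum>k<length xs. pbar p (?g (xs ! k)))"
      by (rule sum.reindex_bij_betw[symmetric]) (use xs bij_betw_nth in blast)
    also have "\<dots> = (\<Sum>k<length (map card xs). p ((map card xs)[k := map card xs ! k + 1]))"
      using 2 by simp
    finally have 3: "(\<Sum>C\<in>\<sigma>. pbar p (?g C)) = \<dots>" .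
    have "pos_seq (map card xs)"
      using xs0 xs finC ne by (auto simp: pos_seq_def card_gt_0_iff)
    then have "p (map card xs) = (\<Sum>k<length (map card xs). p ((map card xs)[k := map card xs ! k + 1]))
        + p (map card xs @ [1])"
      using p unfolding eppf_def by blast
    moreover have "pbar p \<sigma> = p (map card xs)"
      using False by (simp add: pbar_def xs_def)
    ultimately show ?thesis using 1 3 by simp
  qed
  finally show ?thesis .
qed

text \<open>Each extension to \<open>B\<close> passes through exactly one partition of the
  intermediate set \<open>A\<close>, namely its restriction, and the sum is grouped by it. The
  predicate \<open>P\<close> stands for an event already decided on \<open>A\<close>: it is trivial
  for the total mass, and later says that two units share a cluster.\<close>

lemma sum_extensions_group:
  assumes "finite B" "R \<subseteq> A" "A \<subseteq> B"
  shows "(\<Sum>\<pi>\<in>{\<pi>\<in>extensions B R \<sigma>. P (reduced \<pi> A)}. f \<pi>) =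
    (\<Sum>\<tau>\<in>{\<tau>\<in>extensions A R \<sigma>. P \<tau>}. \<Sum>\<pi>\<in>extensions B A \<tau>. (f \<pi> :: real))"
proof -
  have fA: "finite A" using assms finite_subset by blast
  have "(\<Sum>\<tau>\<in>{\<tau>\<in>extensions A R \<sigma>. P \<tau>}.
          \<Sum>\<pi>\<in>{\<pi>\<in>{\<pi>\<in>extensions B R \<sigma>. P (reduced \<pi> A)}. reduced \<pi> A = \<tau>}. f \<pi>)
      = (\<Sum>\<pi>\<in>{\<pi>\<in>extensions B R \<sigma>. P (reduced \<pi> A)}. f \<pi>)"
  proof (rule sum.group)
    show "finite {\<pi>\<in>extensions B R \<sigma>. P (reduced \<pi> A)}" "finite {\<tau>\<in>extensions A R \<sigma>. P \<tau>}"
      using finite_extensions[OF assms(1)] finite_extensions[OF fA] by simp_all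
    show "(\<lambda>\<pi>. reduced \<pi> A) ` {\<pi>\<in>extensions B R \<sigma>. P (reduced \<pi> A)} \<subseteq> {\<tau>\<in>extensions A R \<sigma>. P \<tau>}"
      using assms(2,3) by (auto simp: extensions_def reduced_partition reduced_reduced)
  qed
  \<comment> \<open>Both \<open>P\<close> and the restriction to \<open>R\<close> depend on \<pi>
    only through \<tau>, so the fibre over \<tau> consists of all its extensions.\<close>
  moreover have "{\<pi>\<in>{\<pi>\<in>extensions B R \<sigma>. P (reduced \<pi> A)}. reduced \<pi> A = \<tau>} = extensions B A \<tau>"
    if "\<tau> \<in> {\<tau>\<in>extensions A R \<sigma>. P \<tau>}" for \<tau>
    using that assms(2) reduced_reduced[OF assms(2)] by (fastforce simp: extensions_def)
  ultimately show ?thesis by simp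
qed

text \<open>The units of \<open>A - R\<close> are added one at a time. In each induction step the
  sum is grouped by the restriction before the last unit, and \<open>sum_pbar_one_unit\<close>
  collapses the inner sum.\<close>

lemma sum_pbar_extensions:
  assumes p: "eppf p" and A: "finite A" "R \<subseteq> A" and \<sigma>: "partition_on R \<sigma>"
  shows "(\<Sum>\<tau>\<in>extensions A R \<sigma>. pbar p \<tau>) = pbar p \<sigma>"
proof -
  have R: "finite R" using A finite_subset by blast
  have "(\<Sum>\<tau>\<in>extensions (R \<union> B) R \<sigma>. pbar p \<tau>) = pbar p \<sigma>" if "finite B" "B \<inter> R = {}" for B
    using that
  proof (induction B)
    case empty
    then show ?case using extensions_self[OF \<sigma>] by simp
  next
    case (insert x B)
    have "(\<Sum>\<tau>\<in>extensions (insert x (R \<union> B)) R \<sigma>. pbar p \<tau>) =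
      (\<Sum>\<tau>\<in>extensions (R \<union> B) R \<sigma>. \<Sum>\<pi>\<in>extensions (insert x (R \<union> B)) (R \<union> B) \<tau>. pbar p \<pi>)"
      using sum_extensions_group[of "insert x (R \<union> B)" R "R \<union> B" "pbar p" \<sigma> "\<lambda>_. True"] R insert
      by auto
    also have "\<dots> = (\<Sum>\<tau>\<in>extensions (R \<union> B) R \<sigma>. pbar p \<tau>)"
      using insert R by (intro sum.cong refl sum_pbar_one_unit[OF p]) (auto simp: extensions_def)
    also have "\<dots> = pbar p \<sigma>" using insert by auto
    finally show ?case by simp
  qed
  from this[of "A - R"] A show ?thesis by (simp add: Un_absorb1 Int_commute)
qed

text \<open>Whether \<open>i\<close> and \<open>j\<close> share a cluster is already visible on
  \<open>R \<union> {i, j}\<close>, so all remaining units can be summed out.\<close>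

lemma sum_pbar_same_cluster:
  assumes p: "eppf p" and M: "finite M" "R \<subseteq> M" "i \<in> M" "j \<in> M"
  shows "(\<Sum>\<pi>\<in>{\<pi>\<in>extensions M R \<sigma>. same_cluster \<pi> i j}. pbar p \<pi>) =
    (\<Sum>\<tau>\<in>{\<tau>\<in>extensions (R \<union> {i, j}) R \<sigma>. same_cluster \<tau> i j}. pbar p \<tau>)"
proof -
  let ?A = "R \<union> {i, j}"
  have "(\<Sum>\<pi>\<in>{\<pi>\<in>extensions M R \<sigma>. same_cluster \<pi> i j}. pbar p \<pi>) =
    (\<Sum>\<tau>\<in>{\<tau>\<in>extensions ?A R \<sigma>. same_cluster \<tau> i j}. \<Sum>\<pi>\<in>extensions M ?A \<tau>. pbar p \<pi>)"
    using sum_extensions_group[of M R ?A "pbar p" \<sigma> "\<lambda>\<tau>. same_cluster \<tau> i j"] M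
    by (simp add: same_cluster_reduced subset_insertI2)
  also have "\<dots> = (\<Sum>\<tau>\<in>{\<tau>\<in>extensions ?A R \<sigma>. same_cluster \<tau> i j}. pbar p \<tau>)"
    using M by (intro sum.cong refl sum_pbar_extensions[OF p]) (auto simp: extensions_def)
  finally show ?thesis .
qed

section \<open>Extensions in which two given units share a cluster\<close>

lemma same_cluster_commute: "same_cluster \<tau> i j = same_cluster \<tau> j i"
  by (auto simp: same_cluster_def)

text \<open>Only \<open>j\<close> is new, so the extensions are given by gluing \<open>{j}\<close>
  to a cluster of \<sigma> or leaving it alone. Exactly one of these choices, the cluster of
  \<open>i\<close>, puts \<open>j\<close> together with \<open>i\<close>.\<close>

lemma extensions_join_unit:
  assumes \<sigma>: "partition_on R \<sigma>" and ij: "i \<in> R" "j \<notin> R"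
  shows "{\<tau>\<in>extensions (R \<union> {i, j}) R \<sigma>. same_cluster \<tau> i j} = {join_unit i j \<sigma>}"
proof -
  let ?g = "\<lambda>C. insert (C \<union> {j}) (\<sigma> - {C})"
  have dj: "\<And>B C x. B \<in> \<sigma> \<Longrightarrow> C \<in> \<sigma> \<Longrightarrow> x \<in> B \<Longrightarrow> x \<in> C \<Longrightarrow> B = C"
    and U: "\<Union>\<sigma> = R" using \<sigma> by (auto simp: partition_on_def disjoint_def)
  obtain C where C: "C \<in> \<sigma>" "i \<in> C" using ij U by blast
  have eq: "join_unit i j \<sigma> = ?g C"
  proof -
    have "(\<lambda>B. if i \<in> B then insert j B else B) ` (\<sigma> - {C}) = (\<lambda>B. B) ` (\<sigma> - {C})"
      using C dj by (intro image_cong) auto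
    moreover have "join_unit i j \<sigma> = (\<lambda>B. if i \<in> B then insert j B else B) ` insert C (\<sigma> - {C})"
      unfolding join_unit_def insert_Diff[OF C(1)] ..
    ultimately show ?thesis
      using C(2) unfolding image_insert by simp
  qed
  have RA: "R \<union> {i, j} = R \<union> {j}" using ij by auto
  have im: "?g ` insert {} \<sigma> = {\<tau> \<in> extensions (R \<union> {i, j}) R \<sigma>. \<exists>B\<in>\<tau>. {j} \<subseteq> B}"
    using bij_betw_glue[OF \<sigma>, of "{j}"] ij unfolding RA bij_betw_def by simp
  have iff: "same_cluster (?g X) i j \<longleftrightarrow> X = C" if "X \<in> insert {} \<sigma>" for X
    using that C dj U ij by (auto simp: same_cluster_def)
  have "{\<tau>\<in>extensions (R \<union> {i, j}) R \<sigma>. same_cluster \<tau> i j} = {\<tau> \<in> ?g ` insert {} \<sigma>. same_cluster \<tau> i j}"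
    unfolding im by (auto simp: same_cluster_def)
  also have "\<dots> = {?g C}" using iff C by blast
  finally show ?thesis using eq by simp
qed

text \<open>Both units are new, and sharing a cluster means that \<open>{i, j}\<close> is glued as
  one block. The choices are the clusters of \<sigma> and one new cluster, which receives the number
  \<open>card \<sigma> + 1\<close>.\<close>

lemma sum_join_pair:
  assumes R: "finite R" and \<sigma>: "partition_on R \<sigma>" and ij: "i \<notin> R" "j \<notin> R"
  shows "(\<Sum>\<tau>\<in>{\<tau>\<in>extensions (R \<union> {i, j}) R \<sigma>. same_cluster \<tau> i j}. f \<tau>)
    = (\<Sum>l=1..card \<sigma> + 1. f (join_pair l i j \<sigma>) :: real)"
proof -
  let ?g = "\<lambda>C. insert (C \<union> {i, j}) (\<sigma> - {C})"
  have fin: "finite \<sigma>" using R \<sigma> finite_elements by blast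
  have ne: "{} \<notin> \<sigma>" using \<sigma> by (auto simp: partition_on_def)
  note cl = cluster_list_partition[OF R \<sigma>]
  have *: "{\<tau> \<in> extensions (R \<union> {i, j}) R \<sigma>. \<exists>B\<in>\<tau>. {i, j} \<subseteq> B}
      = {\<tau>\<in>extensions (R \<union> {i, j}) R \<sigma>. same_cluster \<tau> i j}"
    by (auto simp: same_cluster_def)
  have bij: "bij_betw ?g (insert {} \<sigma>) {\<tau>\<in>extensions (R \<union> {i, j}) R \<sigma>. same_cluster \<tau> i j}"
    using bij_betw_glue[OF \<sigma>, of "{i, j}"] ij unfolding * by simp
  have "(\<Sum>\<tau>\<in>{\<tau>\<in>extensions (R \<union> {i, j}) R \<sigma>. same_cluster \<tau> i j}. f \<tau>)
      = (\<Sum>C\<in>insert {} \<sigma>. f (?g C))"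
    by (rule sum.reindex_bij_betw[OF bij, symmetric])
  also have "\<dots> = (\<Sum>C\<in>\<sigma>. f (?g C)) + f (insert {i, j} \<sigma>)"
    using fin ne by simp
  also have "(\<Sum>C\<in>\<sigma>. f (?g C)) = (\<Sum>k<card \<sigma>. f (?g (cluster_list \<sigma> ! k)))"
    using bij_betw_nth[OF cl(2), of "{..<card \<sigma>}" \<sigma>] cl
    by (intro sum.reindex_bij_betw[symmetric]) auto
  also have "\<dots> = (\<Sum>l=1..card \<sigma>. f (join_pair l i j \<sigma>))"
    \<comment> \<open>List positions start at 0 and cluster numbers at 1, hence the shift by
      \<open>Suc\<close>.\<close>
    by (rule sum.reindex_bij_witness[of _ "\<lambda>l. l - 1" Suc]) (auto simp: join_pair_def nth_cluster_def)
  finally show ?thesis by (simp add: join_pair_def)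
qed

section \<open>Cluster labels and the Rand index\<close>

text \<open>The numbering is a bijection from \<open>{1..card \<sigma>}\<close> onto the clusters
  and every unit lies in exactly one cluster, so the description by \<open>THE\<close> has a unique
  witness. This translates between the labels in the claim and the clusters in the sums.\<close>

lemma cluster_label_eq_iff:
  assumes A: "finite A" and \<sigma>: "partition_on A \<sigma>" and ij: "i \<in> A" "j \<in> A"
  shows "cluster_label \<sigma> i = cluster_label \<sigma> j \<longleftrightarrow> same_cluster \<sigma> i j"
proof -
  note cl = cluster_list_partition[OF A \<sigma>]
  have dj: "\<And>B C x. B \<in> \<sigma> \<Longrightarrow> C \<in> \<sigma> \<Longrightarrow> x \<in> B \<Longrightarrow> x \<in> C \<Longrightarrow> B = C"
    and U: "\<Union>\<sigma> = A" using \<sigma> by (auto simp: partition_on_def disjoint_def)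
  have mem: "nth_cluster \<sigma> l \<in> \<sigma>" if "l \<in> {1..card \<sigma>}" for l
  proof -
    have "l - 1 < card \<sigma>" using that by auto
    then show ?thesis
      using nth_mem[of "l - 1" "cluster_list \<sigma>"] cl by (simp add: nth_cluster_def)
  qed
  have inj: "l = l'" if "l \<in> {1..card \<sigma>}" "l' \<in> {1..card \<sigma>}" "nth_cluster \<sigma> l = nth_cluster \<sigma> l'" for l l'
  proof -
    have "l - 1 < card \<sigma>" "l' - 1 < card \<sigma>" using that by auto
    then have "l - 1 = l' - 1"
      using that(3) cl(3) nth_eq_iff_index_eq[OF cl(2), of "l - 1" "l' - 1"]
      by (simp add: nth_cluster_def)
    with that show ?thesis by auto
  qed
  have ex: "\<exists>l\<in>{1..card \<sigma>}. x \<in> nth_cluster \<sigma> l" if x: "x \<in> A" for x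
  proof -
    obtain C where C: "C \<in> \<sigma>" "x \<in> C" using x U by blast
    then obtain k where "k < card \<sigma>" "cluster_list \<sigma> ! k = C"
      using cl by (metis in_set_conv_nth)
    with C show ?thesis by (intro bexI[of _ "Suc k"]) (auto simp: nth_cluster_def)
  qed
  have lab: "cluster_label \<sigma> x \<in> {1..card \<sigma>} \<and> x \<in> nth_cluster \<sigma> (cluster_label \<sigma> x)" if "x \<in> A" for x
  proof -
    obtain l where l: "l \<in> {1..card \<sigma>}" "x \<in> nth_cluster \<sigma> l" using ex[OF \<open>x \<in> A\<close>] by blast
    show ?thesis
      unfolding cluster_label_def
    proof (rule theI, intro conjI)
      fix k assume "k \<in> {1..card \<sigma>} \<and> x \<in> nth_cluster \<sigma> k"
      then show "k = l" using l inj[of k l] dj[OF mem mem, of k l x] by simp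
    qed (use l in simp_all)
  qed
  show ?thesis
  proof
    assume "cluster_label \<sigma> i = cluster_label \<sigma> j"
    then show "same_cluster \<sigma> i j"
      unfolding same_cluster_def using lab[OF ij(1)] lab[OF ij(2)] mem by metis
  next
    assume "same_cluster \<sigma> i j"
    then obtain C where C: "C \<in> \<sigma>" "i \<in> C" "j \<in> C" by (auto simp: same_cluster_def)
    then have "nth_cluster \<sigma> (cluster_label \<sigma> i) = C" "nth_cluster \<sigma> (cluster_label \<sigma> j) = C"
      using lab[OF ij(1)] lab[OF ij(2)] mem dj by blast+
    then show "cluster_label \<sigma> i = cluster_label \<sigma> j"
      using inj lab[OF ij(1)] lab[OF ij(2)] by metis
  qed
qed

text \<open>Counts become sums of indicators, ready for linearity of expectation. Each unordered
  pair is represented by its increasing ordering, which is legitimate because sharing a cluster is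
  symmetric.\<close>

lemma rand_index_eq:
  "rand_index m \<rho>\<^sub>0 \<rho> = (\<Sum>(i, j)\<in>{(i, j). 1 \<le> i \<and> i < j \<and> j \<le> m}.
      of_bool (same_cluster \<rho>\<^sub>0 i j \<and> same_cluster \<rho> i j)
      + of_bool (\<not> same_cluster \<rho>\<^sub>0 i j \<and> \<not> same_cluster \<rho> i j)) / real (m choose 2)"
proof -
  let ?P = "{(i, j). 1 \<le> i \<and> i < j \<and> j \<le> m}"
  have fin: "finite ?P" by (rule finite_subset[of _ "{1..m} \<times> {1..m}"]) auto
  have *: "real (card {{i, j} | i j. i \<in> {1..m} \<and> j \<in> {1..m} \<and> i \<noteq> j \<and> Q i j})
      = (\<Sum>(i, j)\<in>?P. of_bool (Q i j))" if sym: "\<And>i j. Q i j = Q j i" for Q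
  proof -
    have "bij_betw (\<lambda>(i, j). {i, j}) {(i, j)\<in>?P. Q i j}
        {{i, j} | i j. i \<in> {1..m} \<and> j \<in> {1..m} \<and> i \<noteq> j \<and> Q i j}"
    proof (rule bij_betw_imageI)
      show "inj_on (\<lambda>(i, j). {i, j}) {(i, j)\<in>?P. Q i j}"
        by (auto simp: inj_on_def doubleton_eq_iff)
      have sub: "{i, j} \<in> (\<lambda>(i, j). {i, j}) ` {(i, j)\<in>?P. Q i j}"
        if "i \<in> {1..m}" "j \<in> {1..m}" "i \<noteq> j" "Q i j" for i j
      proof (cases "i < j")
        case True
        then show ?thesis using that by (intro image_eqI[of _ _ "(i, j)"]) auto
      next
        case False
        then show ?thesis using that sym by (intro image_eqI[of _ _ "(j, i)"]) auto
      qed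
      show "(\<lambda>(i, j). {i, j}) ` {(i, j)\<in>?P. Q i j} =
        {{i, j} | i j. i \<in> {1..m} \<and> j \<in> {1..m} \<and> i \<noteq> j \<and> Q i j}"
      proof (intro equalityI subsetI)
        fix x assume "x \<in> (\<lambda>(i, j). {i, j}) ` {(i, j)\<in>?P. Q i j}"
        then obtain i j where x: "x = {i, j}" and "1 \<le> i" "i < j" "j \<le> m" "Q i j"
          by auto
        then have "i \<in> {1..m} \<and> j \<in> {1..m} \<and> i \<noteq> j \<and> Q i j" by simp
        with x show "x \<in> {{i, j} | i j. i \<in> {1..m} \<and> j \<in> {1..m} \<and> i \<noteq> j \<and> Q i j}"
          by blast
      qed (use sub in blast)
    qed
    then have "card {{i, j} | i j. i \<in> {1..m} \<and> j \<in> {1..m} \<and> i \<noteq> j \<and> Q i j} = card {(i, j)\<in>?P. Q i j}"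
      by (simp add: bij_betw_same_card)
    moreover have "real (card {(i, j)\<in>?P. Q i j}) = (\<Sum>x\<in>?P. of_bool (case x of (i, j) \<Rightarrow> Q i j))"
      using fin by (simp add: of_bool_def sum.If_cases Int_def case_prod_unfold)
    ultimately show ?thesis by (simp add: case_prod_unfold)
  qed
  show ?thesis
    unfolding rand_index_def
    by (subst (1 2) *) (auto simp: same_cluster_commute sum.distrib case_prod_unfold)
qed

section \<open>The conditional prior given the reallocation indicators\<close>

lemma compatible_eq_extensions:
  "compatible m \<rho>\<^sub>0 \<gamma> = extensions {1..m} (fixed_units m \<gamma>) (reduced \<rho>\<^sub>0 (fixed_units m \<gamma>))"
  by (auto simp: compatible_def extensions_def partitions_upto_def)

text \<open>The three facts rest on one computation: by iterated consistency the normalising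
  constant is \<open>pbar p \<sigma>\<close>. The co-clustering probability is then a ratio over
  \<open>pbar p \<sigma>\<close>, whose numerator needs only the extensions of \<sigma> to
  \<open>R \<union> {i, j}\<close>.\<close>

lemma cond_prior_sums:
  assumes p: "eppf p"
    and pos: "\<And>\<pi>. \<pi> \<in> partitions_upto m \<Longrightarrow> 0 < pbar p \<pi>"
    and \<rho>\<^sub>0: "\<rho>\<^sub>0 \<in> partitions_upto m"
  shows cond_prior_nonneg: "\<pi> \<in> partitions_upto m \<Longrightarrow> 0 \<le> cond_prior p m \<rho>\<^sub>0 \<gamma> \<pi>"
    and sum_cond_prior: "(\<Sum>\<pi>\<in>partitions_upto m. cond_prior p m \<rho>\<^sub>0 \<gamma> \<pi>) = 1"
    and sum_cond_prior_same_cluster: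
      "\<gamma> \<in> Gammas m \<Longrightarrow> i \<in> {1..m} \<Longrightarrow> j \<in> {1..m} \<Longrightarrow>
        (\<Sum>\<pi>\<in>partitions_upto m. cond_prior p m \<rho>\<^sub>0 \<gamma> \<pi> * of_bool (same_cluster \<pi> i j))
          = co_weight p m \<rho>\<^sub>0 i j \<gamma>"
proof -
  define R where "R = fixed_units m \<gamma>"
  define \<sigma> where "\<sigma> = reduced \<rho>\<^sub>0 R"
  have R: "R \<subseteq> {1..m}" "finite R" by (auto simp: R_def fixed_units_def)
  have part0: "partition_on {1..m} \<rho>\<^sub>0" using \<rho>\<^sub>0 by (simp add: partitions_upto_def)
  have \<sigma>: "partition_on R \<sigma>"
    using reduced_partition[OF part0 R(1)] by (simp add: \<sigma>_def)
  have fin: "finite (partitions_upto m)"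
    using finitely_many_partition_on[of "{1..m}"] by (simp add: partitions_upto_def)
  have comp: "compatible m \<rho>\<^sub>0 \<gamma> = extensions {1..m} R \<sigma>"
    by (simp add: compatible_eq_extensions R_def \<sigma>_def)
  have sub: "extensions {1..m} R \<sigma> \<subseteq> partitions_upto m"
    by (auto simp: extensions_def partitions_upto_def)
  have restr: "(\<Sum>\<pi>\<in>partitions_upto m. f \<pi> * of_bool (\<pi> \<in> extensions {1..m} R \<sigma>) * of_bool (Q \<pi>))
      = (\<Sum>\<pi>\<in>{\<pi>\<in>extensions {1..m} R \<sigma>. Q \<pi>}. f \<pi>)" for f :: "nat set set \<Rightarrow> real" and Q
    using sub by (intro sum.mono_neutral_cong_right fin) auto
  have den: "(\<Sum>\<rho>'\<in>partitions_upto m. pbar p \<rho>' * of_bool (\<rho>' \<in> compatible m \<rho>\<^sub>0 \<gamma>)) = pbar p \<sigma>"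
    using restr[of "pbar p" "\<lambda>_. True"] sum_pbar_extensions[OF p _ R(1) \<sigma>] by (simp add: comp)
  \<comment> \<open>Positivity is assumed for partitions of \<open>{1..m}\<close> only. It passes to
    \<sigma> because \<open>pbar p \<sigma>\<close> is the sum over its extensions, among which is
    \<open>\<rho>\<^sub>0\<close>.\<close>
  have "0 < (\<Sum>\<tau>\<in>extensions {1..m} R \<sigma>. pbar p \<tau>)"
    using sub pos part0 finite_extensions by (intro sum_pos) (auto simp: extensions_def \<sigma>_def)
  then have pos\<sigma>: "0 < pbar p \<sigma>" using sum_pbar_extensions[OF p _ R(1) \<sigma>] by simp
  have cp: "cond_prior p m \<rho>\<^sub>0 \<gamma> \<pi> = pbar p \<pi> * of_bool (\<pi> \<in> extensions {1..m} R \<sigma>) / pbar p \<sigma>" for \<pi>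
    unfolding cond_prior_def den unfolding comp ..
  show "0 \<le> cond_prior p m \<rho>\<^sub>0 \<gamma> \<pi>" if "\<pi> \<in> partitions_upto m"
    using pos[OF that] pos\<sigma> by (simp add: cp)
  show "(\<Sum>\<pi>\<in>partitions_upto m. cond_prior p m \<rho>\<^sub>0 \<gamma> \<pi>) = 1"
    using den pos\<sigma> by (simp add: cp comp flip: sum_divide_distrib)
  show "(\<Sum>\<pi>\<in>partitions_upto m. cond_prior p m \<rho>\<^sub>0 \<gamma> \<pi> * of_bool (same_cluster \<pi> i j))
          = co_weight p m \<rho>\<^sub>0 i j \<gamma>"
    if \<gamma>: "\<gamma> \<in> Gammas m" and ij: "i \<in> {1..m}" "j \<in> {1..m}"
  proof -
    let ?S = "\<Sum>\<tau>\<in>{\<tau>\<in>extensions (R \<union> {i, j}) R \<sigma>. same_cluster \<tau> i j}. pbar p \<tau>"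
    have "(\<Sum>\<pi>\<in>partitions_upto m. cond_prior p m \<rho>\<^sub>0 \<gamma> \<pi> * of_bool (same_cluster \<pi> i j))
        = (\<Sum>\<pi>\<in>{\<pi>\<in>extensions {1..m} R \<sigma>. same_cluster \<pi> i j}. pbar p \<pi>) / pbar p \<sigma>"
      unfolding restr[symmetric] by (simp add: cp sum_divide_distrib)
    also have "\<dots> = ?S / pbar p \<sigma>"
      using sum_pbar_same_cluster[OF p _ R(1) ij] by simp
    also have "\<dots> = co_weight p m \<rho>\<^sub>0 i j \<gamma>"
    proof -
      have mem: "k \<in> R \<longleftrightarrow> \<gamma> k = 1" "\<gamma> k \<noteq> 1 \<longleftrightarrow> \<gamma> k = 0" if "k \<in> {1..m}" for k
        using \<gamma> that by (auto simp: R_def fixed_units_def Gammas_def PiE_iff)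
      note m = mem[OF ij(1)] mem[OF ij(2)]
      note cw = co_weight_def[of p m \<rho>\<^sub>0 i j \<gamma>, folded R_def, folded \<sigma>_def, unfolded Let_def]
      consider "i \<in> R" "j \<in> R" | "i \<in> R" "j \<notin> R" | "i \<notin> R" "j \<in> R" | "i \<notin> R" "j \<notin> R"
        by blast
      then show ?thesis
      proof cases
        case 1
        then have "same_cluster \<sigma> i j \<longleftrightarrow> cluster_label \<rho>\<^sub>0 i = cluster_label \<rho>\<^sub>0 j"
          using cluster_label_eq_iff[OF _ part0 ij] by (simp add: \<sigma>_def same_cluster_reduced)
        \<comment> \<open>With both units fixed nothing is added to \<open>R\<close>, so \<sigma> is
          its own only extension and the ratio is 1 or 0.\<close>
        moreover have "{\<tau>\<in>extensions (R \<union> {i, j}) R \<sigma>. same_cluster \<tau> i j} = {\<tau>\<in>{\<sigma>}. same_cluster \<tau> i j}"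
          using 1 extensions_self[OF \<sigma>] by (simp add: insert_absorb)
        moreover have "{\<tau>\<in>{\<sigma>}. same_cluster \<tau> i j} = (if same_cluster \<sigma> i j then {\<sigma>} else {})"
          by auto
        ultimately show ?thesis using 1 m pos\<sigma> by (simp add: cw)
      next
        case 2
        then show ?thesis using extensions_join_unit[OF \<sigma> 2] m by (simp add: cw)
      next
        case 3
        have "?S = pbar p (join_unit j i \<sigma>)"
          using extensions_join_unit[OF \<sigma> 3(2,1)]
          by (simp add: insert_commute same_cluster_commute[of _ i j])
        then show ?thesis using 3 m by (simp add: cw)
      next
        case 4
        then show ?thesis
          using sum_join_pair[OF R(2) \<sigma> 4, of "pbar p"] m by (simp add: cw add_divide_distrib sum_divide_distrib)
      qed
    qed
    finally show ?thesis .
  qed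
qed

section \<open>Expectation of the Rand index under the informed prior\<close>

theorem proposition2:
  fixes p :: "nat list \<Rightarrow> real" and m :: nat and \<rho>\<^sub>0 :: "nat set set" and \<alpha> :: "nat \<Rightarrow> real"
    and \<Omega> :: "'w measure" and \<rho> :: "'w \<Rightarrow> nat set set"
  assumes "2 \<le> m"
    and "eppf p"
    and "\<And>\<pi>. \<pi> \<in> partitions_upto m \<Longrightarrow> 0 < pbar p \<pi>"
    and "\<rho>\<^sub>0 \<in> partitions_upto m"
    and "\<And>i. i \<in> {1..m} \<Longrightarrow> 0 \<le> \<alpha> i \<and> \<alpha> i \<le> 1"
    and "prob_space \<Omega>"
    and "distributed \<Omega> (count_space (partitions_upto m)) \<rho> (\<lambda>\<pi>. ennreal (informed_prior p m \<rho>\<^sub>0 \<alpha> \<pi>))"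
  shows "prob_space.expectation \<Omega> (\<lambda>\<omega>. rand_index m \<rho>\<^sub>0 (\<rho> \<omega>)) =
    1 / real (m choose 2) *
    (\<Sum>\<gamma>\<in>Gammas m. \<Sum>(i, j)\<in>{(i, j). 1 \<le> i \<and> i < j \<and> j \<le> m}.
       (co_weight p m \<rho>\<^sub>0 i j \<gamma> * of_bool (cluster_label \<rho>\<^sub>0 i = cluster_label \<rho>\<^sub>0 j)
        + (1 - co_weight p m \<rho>\<^sub>0 i j \<gamma>) * of_bool (cluster_label \<rho>\<^sub>0 i \<noteq> cluster_label \<rho>\<^sub>0 j))
       * gamma_prob m \<alpha> \<gamma>)"
proof -
  let ?P = "{(i, j). 1 \<le> i \<and> i < j \<and> j \<le> m}"
  let ?N = "real (m choose 2)"
  note cs = assms(2-4)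
  have part0: "partition_on {1..m} \<rho>\<^sub>0" using assms(4) by (simp add: partitions_upto_def)
  have fin: "finite (partitions_upto m)"
    using finitely_many_partition_on[of "{1..m}"] by (simp add: partitions_upto_def)
  have gp: "0 \<le> gamma_prob m \<alpha> \<gamma>" for \<gamma>
    using assms(5) by (auto simp: gamma_prob_def intro!: prod_nonneg)
  \<comment> \<open>The density is given through \<open>ennreal\<close>, which sends negative reals
    to 0; nonnegativity ensures that it represents the prior faithfully.\<close>
  have nonneg: "0 \<le> informed_prior p m \<rho>\<^sub>0 \<alpha> \<pi>" if "\<pi> \<in> partitions_upto m" for \<pi>
    using cond_prior_nonneg[OF cs that] gp by (auto simp: informed_prior_def intro!: sum_nonneg)
  \<comment> \<open>According to whether \<open>\<rho>\<^sub>0\<close> joins or separates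
    \<open>i\<close> and \<open>j\<close>, the bracket is the indicator that \<pi> joins them or its
    complement. As the conditional prior has total mass 1, the result is the co-clustering
    probability or 1 minus it.\<close>
  have pair: "(\<Sum>\<pi>\<in>partitions_upto m. cond_prior p m \<rho>\<^sub>0 \<gamma> \<pi> *
        (of_bool (same_cluster \<rho>\<^sub>0 i j \<and> same_cluster \<pi> i j)
         + of_bool (\<not> same_cluster \<rho>\<^sub>0 i j \<and> \<not> same_cluster \<pi> i j)))
      = co_weight p m \<rho>\<^sub>0 i j \<gamma> * of_bool (cluster_label \<rho>\<^sub>0 i = cluster_label \<rho>\<^sub>0 j)
        + (1 - co_weight p m \<rho>\<^sub>0 i j \<gamma>) * of_bool (cluster_label \<rho>\<^sub>0 i \<noteq> cluster_label \<rho>\<^sub>0 j)"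
    if \<gamma>: "\<gamma> \<in> Gammas m" and ij: "(i, j) \<in> ?P" for \<gamma> i j
  proof -
    have ij': "i \<in> {1..m}" "j \<in> {1..m}" using ij by auto
    show ?thesis
      using sum_cond_prior_same_cluster[OF cs \<gamma> ij'] sum_cond_prior[OF cs, of \<gamma>]
        cluster_label_eq_iff[OF _ part0 ij']
      by (cases "same_cluster \<rho>\<^sub>0 i j") (simp_all add: of_bool_not_iff right_diff_distrib sum_subtractf)
  qed
  have "prob_space.expectation \<Omega> (\<lambda>\<omega>. rand_index m \<rho>\<^sub>0 (\<rho> \<omega>)) =
      (LINT \<pi>|count_space (partitions_upto m). informed_prior p m \<rho>\<^sub>0 \<alpha> \<pi> * rand_index m \<rho>\<^sub>0 \<pi>)"
    by (rule distributed_integral[OF assms(7), symmetric]) (use nonneg in auto)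
  also have "\<dots> = (\<Sum>\<pi>\<in>partitions_upto m. informed_prior p m \<rho>\<^sub>0 \<alpha> \<pi> * rand_index m \<rho>\<^sub>0 \<pi>)"
    by (rule lebesgue_integral_count_space_finite[OF fin])
  also have "\<dots> = 1 / ?N * (\<Sum>\<pi>\<in>partitions_upto m. \<Sum>\<gamma>\<in>Gammas m. \<Sum>(i, j)\<in>?P.
      cond_prior p m \<rho>\<^sub>0 \<gamma> \<pi> *
        (of_bool (same_cluster \<rho>\<^sub>0 i j \<and> same_cluster \<pi> i j)
         + of_bool (\<not> same_cluster \<rho>\<^sub>0 i j \<and> \<not> same_cluster \<pi> i j)) * gamma_prob m \<alpha> \<gamma>)"
    unfolding rand_index_eq informed_prior_def sum_distrib_left
    by (intro sum.cong refl)
      (simp add: sum_distrib_left sum_distrib_right sum_divide_distrib case_prod_unfold mult_ac,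
        rule sum.swap)
  \<comment> \<open>The sum over \<pi> is moved past those over \<gamma> and over the pairs, so that
    \<open>pair\<close> can evaluate it with both held fixed.\<close>
  also have "\<dots> = 1 / ?N * (\<Sum>\<gamma>\<in>Gammas m. \<Sum>(i, j)\<in>?P. (\<Sum>\<pi>\<in>partitions_upto m.
      cond_prior p m \<rho>\<^sub>0 \<gamma> \<pi> *
        (of_bool (same_cluster \<rho>\<^sub>0 i j \<and> same_cluster \<pi> i j)
         + of_bool (\<not> same_cluster \<rho>\<^sub>0 i j \<and> \<not> same_cluster \<pi> i j))) * gamma_prob m \<alpha> \<gamma>)"
    unfolding sum_distrib_right case_prod_unfold
    by (subst sum.swap, subst (2) sum.swap) (rule refl)
  also have "\<dots> = 1 / ?N * (\<Sum>\<gamma>\<in>Gammas m. \<Sum>(i, j)\<in>?P.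
       (co_weight p m \<rho>\<^sub>0 i j \<gamma> * of_bool (cluster_label \<rho>\<^sub>0 i = cluster_label \<rho>\<^sub>0 j)
        + (1 - co_weight p m \<rho>\<^sub>0 i j \<gamma>) * of_bool (cluster_label \<rho>\<^sub>0 i \<noteq> cluster_label \<rho>\<^sub>0 j))
       * gamma_prob m \<alpha> \<gamma>)"
    by (intro arg_cong[where f = "(*) (1 / ?N)"] sum.cong refl) (use pair in \<open>auto simp del: of_bool_eq\<close>)
  finally show ?thesis .
qed

end
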